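(* Let $(\sigma,\tau_0,\tau_1)$ be any triple in the class of $(e,(12),(12))$ or of $(e,(13),e)$. Then for every infinite sequence $(i_1,i_2,\ldots)\in\{0,1\}^{\mathbb{N}}$ containing infinitely many zeros and infinitely many ones, $\bigcap_{n}\Gamma_{(\sigma,\tau_0,\tau_1)}(i_1,\ldots,i_n)$ is a single point; in particular, $\Phi(\sigma,\tau_0,\tau_1)(x,y)$ is a single point whenever $(x,y)$ lies in the interior of every $\triangle_{(\sigma,\tau_0,\tau_1)}(i_1,\ldots,i_n)$ for such a sequence.
   Context: Let $\triangle=\{(x,y):1>x>y>0\}$, $\pi(x,y,z)=(y/x,z/x)$, and for a $3\times3$ matrix $M$ with nonzero first-row entries $\pi(M)$ is the closed triangle with vertices the $\pi$-images of the columns of $M$ (in column order). $V=\begin{pmatrix}1&1&1\\0&1&1\\0&0&1\end{pmatrix}$, $F_0=\begin{pmatrix}0&0&1\\1&0&0\\0&1&1\end{pmatrix}$, $F_1=\begin{pmatrix}1&0&1\\0&1&0\\0&0&1\end{pmatrix}$, $G_0=\begin{pmatrix}0&0&1/2\\1&0&0\\0&1&1/2\end{pmatrix}$, $G_1=\begin{pmatrix}1&0&1/2\\0&1&0\\0&0&1/2\end{pmatrix}$. Elements of $S_3$ are permutation matrices: $e=I$, $(12)=\begin{pmatrix}0&1&0\\1&0&0\\0&0&1\end{pmatrix}$, $(13)=\begin{pmatrix}0&0&1\\0&1&0\\1&0&0\end{pmatrix}$, $(23)=\begin{pmatrix}1&0&0\\0&0&1\\0&1&0\end{pmatrix}$,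 $(123)=\begin{pmatrix}0&1&0\\0&0&1\\1&0&0\end{pmatrix}$, $(132)=\begin{pmatrix}0&0&1\\1&0&0\\0&1&0\end{pmatrix}$. For $(\sigma,\tau_0,\tau_1)\in S_3^3$: $F_i(\sigma,\tau_0,\tau_1)=\sigma F_i\tau_i$, $G_i(\sigma,\tau_0,\tau_1)=\sigma G_i\tau_i$, $\triangle_{(\sigma,\tau_0,\tau_1)}(i_1,\ldots,i_n)=\pi(VF_{i_1}(\sigma,\tau_0,\tau_1)\cdots F_{i_n}(\sigma,\tau_0,\tau_1))$, $\Gamma_{(\sigma,\tau_0,\tau_1)}(i_1,\ldots,i_n)=\pi(VG_{i_1}(\sigma,\tau_0,\tau_1)\cdots G_{i_n}(\sigma,\tau_0,\tau_1))$. The class of a triple is the smallest subset of $S_3^3$ containing it and closed under $(\sigma,\tau_0,\tau_1)\mapsto(\sigma(13),(12)\tau_1,(12)\tau_0)$ and $(\sigma,\tau_0,\tau_1)\mapsto(\rho\sigma,\tau_0\rho^{-1},\tau_1\rho^{-1})$ for $\rho\in S_3$. The relation $\Phi(\sigma,\tau_0,\tau_1)$: if $(x,y)$ lies in the interior of $\triangle_{(\sigma,\tau_0,\tau_1)}(i_1,\ldots,i_n)$ for all $n$, then $\Phi(\sigma,\tau_0,\tau_1)(x,y)=\bigcap_n\Gamma_{(\sigma,\tau_0,\tau_1)}(i_1,\ldots,i_n)$. *)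

theory Defs
  imports "HOL-Analysis.Analysis"
begin

type_synonym mat3 = "real ^ 3 ^ 3"
type_synonym triple = "mat3 \<times> mat3 \<times> mat3"

text \<open>Matrices are given by their lists of rows.\<close>

definition mV :: mat3 where
  "mV = vector [vector [1, 1, 1], vector [0, 1, 1], vector [0, 0, 1]]"

definition mF0 :: mat3 where
  "mF0 = vector [vector [0, 0, 1], vector [1, 0, 0], vector [0, 1, 1]]"

definition mF1 :: mat3 where
  "mF1 = vector [vector [1, 0, 1], vector [0, 1, 0], vector [0, 0, 1]]"

definition mG0 :: mat3 where
  "mG0 = vector [vector [0, 0, 1/2], vector [1, 0, 0], vector [0, 1, 1/2]]"

definition mG1 :: mat3 where
  "mG1 = vector [vector [1, 0, 1/2], vector [0, 1, 0], vector [0, 0, 1/2]]"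

definition pe :: mat3 where
  "pe = vector [vector [1, 0, 0], vector [0, 1, 0], vector [0, 0, 1]]"

definition p12 :: mat3 where
  "p12 = vector [vector [0, 1, 0], vector [1, 0, 0], vector [0, 0, 1]]"

definition p13 :: mat3 where
  "p13 = vector [vector [0, 0, 1], vector [0, 1, 0], vector [1, 0, 0]]"

definition p23 :: mat3 where
  "p23 = vector [vector [1, 0, 0], vector [0, 0, 1], vector [0, 1, 0]]"

definition p123 :: mat3 where
  "p123 = vector [vector [0, 1, 0], vector [0, 0, 1], vector [1, 0, 0]]"

definition p132 :: mat3 where
  "p132 = vector [vector [0, 0, 1], vector [1, 0, 0], vector [0, 1, 0]]"

definition S3 :: "mat3 set" where
  "S3 = {pe, p12, p13, p23, p123, p132}"

definition proj :: "real ^ 3 \<Rightarrow> real \<times> real" where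
  "proj v = (v $ 2 / v $ 1, v $ 3 / v $ 1)"

text \<open>Only used for matrices whose first row has no zero entry.\<close>

definition proj_triangle :: "mat3 \<Rightarrow> (real \<times> real) set" where
  "proj_triangle M = convex hull {proj (column 1 M), proj (column 2 M), proj (column 3 M)}"

text \<open>Digits are the naturals 0 and 1; the value at any other digit is irrelevant.\<close>

fun F_tw :: "triple \<Rightarrow> nat \<Rightarrow> mat3" where
  "F_tw (\<sigma>, \<tau>0, \<tau>1) k = (if k = 0 then \<sigma> ** mF0 ** \<tau>0 else \<sigma> ** mF1 ** \<tau>1)"

fun G_tw :: "triple \<Rightarrow> nat \<Rightarrow> mat3" where
  "G_tw (\<sigma>, \<tau>0, \<tau>1) k = (if k = 0 then \<sigma> ** mG0 ** \<tau>0 else \<sigma> ** mG1 ** \<tau>1)"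

definition mat_prod :: "mat3 list \<Rightarrow> mat3" where
  "mat_prod Ms = foldr (**) Ms (mat 1)"

definition Tri :: "triple \<Rightarrow> nat list \<Rightarrow> (real \<times> real) set" where
  "Tri t ks = proj_triangle (mV ** mat_prod (map (F_tw t) ks))"

definition Gam :: "triple \<Rightarrow> nat list \<Rightarrow> (real \<times> real) set" where
  "Gam t ks = proj_triangle (mV ** mat_prod (map (G_tw t) ks))"

inductive_set triple_class :: "triple \<Rightarrow> triple set" for t :: triple where
  base: "t \<in> triple_class t"
| swap: "(\<sigma>, \<tau>0, \<tau>1) \<in> triple_class t \<Longrightarrow> (\<sigma> ** p13, p12 ** \<tau>1, p12 ** \<tau>0) \<in> triple_class t"
| conj: "(\<sigma>, \<tau>0, \<tau>1) \<in> triple_class t \<Longrightarrow> \<rho> \<in> S3 \<Longrightarrow>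
    (\<rho> ** \<sigma>, \<tau>0 ** matrix_inv \<rho>, \<tau>1 ** matrix_inv \<rho>) \<in> triple_class t"

text \<open>A sequence \<open>(i\<^sub>1, i\<^sub>2, \<dots>)\<close> is a function on the naturals with \<open>i k\<close> in the role of
  \<open>i\<^sub>k\<^sub>+\<^sub>1\<close>, so \<open>prefix i n\<close> is the word \<open>i\<^sub>1 \<dots> i\<^sub>n\<close>.\<close>

definition binary_seq :: "(nat \<Rightarrow> nat) \<Rightarrow> bool" where
  "binary_seq i \<longleftrightarrow> (\<forall>k. i k \<in> {0, 1})"

definition prefix :: "(nat \<Rightarrow> nat) \<Rightarrow> nat \<Rightarrow> nat list" where
  "prefix i n = map i [0..<n]"

text \<open>The relation pairs \<open>p\<close> with every point of the intersection belonging to any sequence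
  whose triangles all have \<open>p\<close> in their interior; \<open>Phi t `` {p}\<close> is the value at \<open>p\<close>.\<close>

definition Phi :: "triple \<Rightarrow> ((real \<times> real) \<times> (real \<times> real)) set" where
  "Phi t = {(p, q). \<exists>i. binary_seq i \<and> (\<forall>n\<ge>1. p \<in> interior (Tri t (prefix i n))) \<and>
      q \<in> (\<Inter>n\<in>{1..}. Gam t (prefix i n))}"

end

(* A step of the map G replaces the triangle ABC by one with the vertices B, C or A, B together
   with the midpoint of AC. For (e,(12),(12)) the word 10, and for (e,(13),e) the word 01, shrinks
   the diameter of every triangle by the factor 3/4, because the three new vertices are
   midpoint(A,C), one of the ends of AC, and midpoint(B, midpoint(A,C)). Moving within a class only
   permutes the initial columns or exchanges the digits, so every triple of the two classes has such
   a word 01 or 10. It occurs infinitely often in the sequence, while the other steps do not increase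
   the diameter, hence the nested triangles shrink to a point.
   Each step of the map F cuts a triangle by a line into two triangles, so a point that is interior
   to all the triangles of a sequence determines the sequence. *)

theory Submission
  imports Defs
begin

section \<open>Permutation matrices and the action of the steps on columns\<close>

lemmas mat3_eqs = vec_eq_iff forall_3 matrix_matrix_mult_def sum_3 vector_3 column_def mat_def
lemmas perm_defs = pe_def p12_def p13_def p23_def p123_def p132_def

lemma columns_3: "columns (M :: mat3) = {column 1 M, column 2 M, column 3 M}"
  unfolding columns_def by (auto, metis exhaust_3)

lemma column_p:
  fixes M :: mat3
  shows "M ** pe = M"
    and "column 1 (M ** p12) = column 2 M" "column 2 (M ** p12) = column 1 M" "column 3 (M ** p12) = column 3 M"
    and "column 1 (M ** p13) = column 3 M" "column 2 (M ** p13) = column 2 M" "column 3 (M ** p13) = column 1 M"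
    and "column 1 (M ** p23) = column 1 M" "column 2 (M ** p23) = column 3 M" "column 3 (M ** p23) = column 2 M"
    and "column 1 (M ** p123) = column 3 M" "column 2 (M ** p123) = column 1 M" "column 3 (M ** p123) = column 2 M"
    and "column 1 (M ** p132) = column 2 M" "column 2 (M ** p132) = column 3 M" "column 3 (M ** p132) = column 1 M"
  by (simp_all add: mat3_eqs perm_defs)

lemma column_G:
  fixes M :: mat3
  shows "column 1 (M ** mG0) = column 2 M" "column 2 (M ** mG0) = column 3 M"
      "column 3 (M ** mG0) = midpoint (column 1 M) (column 3 M)"
    and "column 1 (M ** mG1) = column 1 M" "column 2 (M ** mG1) = column 2 M"
      "column 3 (M ** mG1) = midpoint (column 1 M) (column 3 M)"
  by (simp_all add: mat3_eqs mG0_def mG1_def midpoint_def)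

lemma column_F:
  fixes M :: mat3
  shows "column 1 (M ** mF0) = column 2 M" "column 2 (M ** mF0) = column 3 M"
      "column 3 (M ** mF0) = column 1 M + column 3 M"
    and "column 1 (M ** mF1) = column 1 M" "column 2 (M ** mF1) = column 2 M"
      "column 3 (M ** mF1) = column 1 M + column 3 M"
  by (simp_all add: mat3_eqs mF0_def mF1_def)

lemma columns_S3:
  fixes M :: mat3
  shows "\<rho> \<in> S3 \<Longrightarrow> columns (M ** \<rho>) = columns M"
  by (auto simp: S3_def columns_3 column_p)

lemma S3_mult: "\<rho> \<in> S3 \<Longrightarrow> \<rho>' \<in> S3 \<Longrightarrow> \<rho> ** \<rho>' \<in> S3"
  unfolding S3_def
  by (elim insertE emptyE; simp add: column_p(1); simp add: mat3_eqs perm_defs)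

text \<open>\<open>matrix_inv\<close> is a Hilbert choice, so it is pinned down by comparison with
  the transpose, a two-sided inverse of a permutation matrix.\<close>

lemma S3_inverse:
  assumes "\<rho> \<in> S3"
  shows "matrix_inv \<rho> \<in> S3" "matrix_inv \<rho> ** \<rho> = mat 1" "invertible \<rho>"
proof -
  have *: "transpose \<rho> \<in> S3" "\<rho> ** transpose \<rho> = mat 1" "transpose \<rho> ** \<rho> = mat 1"
    using assms unfolding S3_def
    by (elim insertE emptyE; simp add: mat3_eqs perm_defs transpose_def)+
  then have "\<rho> ** matrix_inv \<rho> = mat 1 \<and> matrix_inv \<rho> ** \<rho> = mat 1"
    unfolding matrix_inv_def by (intro someI) blast
  then have "matrix_inv \<rho> = transpose \<rho>"
    using * by (metis matrix_mul_assoc matrix_mul_lid matrix_mul_rid)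
  with * show "matrix_inv \<rho> \<in> S3" "matrix_inv \<rho> ** \<rho> = mat 1" "invertible \<rho>"
    by (auto simp: invertible_def)
qed

section \<open>Contraction for the two generating triples\<close>

text \<open>The type \<open>triple\<close> admits arbitrary matrices; this predicate carries the
  restriction to permutations along a class.\<close>

definition S3_triple :: "triple \<Rightarrow> bool" where
  "S3_triple t \<longleftrightarrow> (\<exists>\<sigma>\<in>S3. \<exists>\<tau>0\<in>S3. \<exists>\<tau>1\<in>S3. t = (\<sigma>, \<tau>0, \<tau>1))"

lemma S3_triple_iff: "S3_triple (\<sigma>, \<tau>0, \<tau>1) \<longleftrightarrow> \<sigma> \<in> S3 \<and> \<tau>0 \<in> S3 \<and> \<tau>1 \<in> S3"
  by (auto simp: S3_triple_def)

text \<open>Distances are measured between columns in \<open>real ^ 3\<close>, before projection.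
  Quantifying over every \<open>M\<close> lets a permutation in front of the word be absorbed into
  \<open>M\<close>.\<close>

definition contracts :: "triple \<Rightarrow> nat \<Rightarrow> nat \<Rightarrow> bool" where
  "contracts t a b \<longleftrightarrow>
    (\<forall>M :: mat3. diameter (columns (M ** G_tw t a ** G_tw t b)) \<le> 3/4 * diameter (columns M))"

lemma finite_columns: "finite (columns (M :: mat3))"
  by (simp add: columns_3)

text \<open>Any distance within a polytope is bounded by one between two vertices.\<close>

lemma diameter_convex_hull_finite:
  fixes S :: "'a :: real_inner set"
  assumes "finite S"
  shows "diameter (convex hull S) = diameter S"
proof (cases "S = {}")
  case False
  have bdd: "bounded S" "bounded (convex hull S)"
    using assms by (simp_all add: finite_imp_bounded bounded_convex_hull)
  show ?thesis
  proof (rule antisym)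
    show "diameter (convex hull S) \<le> diameter S"
    proof (rule diameter_le)
      fix x y assume "x \<in> convex hull S" "y \<in> convex hull S"
      then obtain u v where "u \<in> S" "v \<in> S" "norm (x - y) \<le> norm (u - v)"
        using simplex_extremal_le_exists[OF assms] by blast
      then show "norm (x - y) \<le> diameter S"
        using diameter_bounded_bound[OF bdd(1), of u v] by (simp add: dist_norm)
    qed (use False in simp)
    show "diameter S \<le> diameter (convex hull S)"
      by (intro diameter_subset hull_subset bdd)
  qed
qed simp

text \<open>Differences of the new vertices are combinations of the old sides with absolute weights
  summing to 1/2, 3/4 and 1/2; the pair \<open>A\<close>, \<open>midpoint B (midpoint A C)\<close>
  dictates the 3/4.\<close>

lemma diameter_weighted_triangle:
  fixes A B C :: "'a :: real_normed_vector"
  shows "diameter {midpoint A C, A, midpoint B (midpoint A C)} \<le> 3/4 * diameter {A, B, C}"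
proof -
  let ?d = "diameter {A, B, C}"
  have b: "bounded {A, B, C}" by simp
  have AB: "norm (A - B) \<le> ?d" and AC: "norm (A - C) \<le> ?d" and BC: "norm (B - C) \<le> ?d"
    using diameter_bounded_bound[OF b] by (auto simp: dist_norm)
  have d: "0 \<le> ?d" by (rule diameter_ge_0[OF b])
  have 1: "norm (midpoint A C - A) \<le> 3/4 * ?d"
  proof -
    have "midpoint A C - A = (-1/2) *\<^sub>R (A - C)"
      by (simp add: midpoint_def algebra_simps flip: scaleR_left_distrib)
    then show ?thesis using AC d by simp
  qed
  have 2: "norm (A - midpoint B (midpoint A C)) \<le> 3/4 * ?d"
  proof -
    have "A - midpoint B (midpoint A C) = (1/2) *\<^sub>R (A - B) + (1/4) *\<^sub>R (A - C)"
      by (simp add: midpoint_def algebra_simps flip: scaleR_left_distrib)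
    also have "norm \<dots> \<le> 1/2 * norm (A - B) + 1/4 * norm (A - C)"
      by (rule order_trans[OF norm_triangle_ineq]) simp
    finally show ?thesis using AB AC by linarith
  qed
  have 3: "norm (midpoint A C - midpoint B (midpoint A C)) \<le> 3/4 * ?d"
  proof -
    have "midpoint A C - midpoint B (midpoint A C) = (1/4) *\<^sub>R (A - B) + (-1/4) *\<^sub>R (B - C)"
      by (simp add: midpoint_def algebra_simps flip: scaleR_left_distrib)
    also have "norm \<dots> \<le> 1/4 * norm (A - B) + 1/4 * norm (B - C)"
      by (rule order_trans[OF norm_triangle_ineq]) simp
    finally show ?thesis using AB BC d by linarith
  qed
  show ?thesis
    using 1 2 3 d by (intro diameter_le) (auto simp: norm_minus_commute)
qed

text \<open>With D the midpoint of A and C, the columns go (A, B, C) -> (B, A, D) -> (D, A, midpoint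
  of B and D).\<close>

lemma contracts_p12: "contracts (pe, p12, p12) 1 0"
  unfolding contracts_def
proof
  fix M :: mat3
  let ?A = "column 1 M" and ?B = "column 2 M" and ?C = "column 3 M"
  show "diameter (columns (M ** G_tw (pe, p12, p12) 1 ** G_tw (pe, p12, p12) 0))
      \<le> 3/4 * diameter (columns M)"
    using diameter_weighted_triangle[of ?A ?C ?B]
    by (simp add: columns_3 matrix_mul_assoc column_p column_G)
qed

text \<open>Here (A, B, C) -> (D, C, B) -> (D, C, midpoint of D and B): the end C survives instead
  of A, so A and C trade places in the estimate.\<close>

lemma contracts_p13: "contracts (pe, p13, pe) 0 1"
  unfolding contracts_def
proof
  fix M :: mat3
  let ?A = "column 1 M" and ?B = "column 2 M" and ?C = "column 3 M"
  show "diameter (columns (M ** G_tw (pe, p13, pe) 0 ** G_tw (pe, p13, pe) 1))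
      \<le> 3/4 * diameter (columns M)"
    using diameter_weighted_triangle[of ?C ?A ?B]
    by (simp add: columns_3 matrix_mul_assoc column_p column_G insert_commute midpoint_sym)
qed

text \<open>Exchanging A and C interchanges the two steps up to the order of the first two new
  columns; hence the class move \<open>swap\<close> exchanges the digits.\<close>

lemma p13_G_p12: "p13 ** mG0 ** p12 = mG1" "p13 ** mG1 ** p12 = mG0"
  by (simp_all add: mat3_eqs perm_defs mG0_def mG1_def)

lemma G_tw_swap:
  assumes "k \<in> {0, 1}"
  shows "G_tw (\<sigma> ** p13, p12 ** \<tau>1, p12 ** \<tau>0) k = G_tw (\<sigma>, \<tau>0, \<tau>1) (1 - k)"
proof -
  have "\<sigma> ** p13 ** N ** (p12 ** \<tau>) = \<sigma> ** (p13 ** N ** p12) ** \<tau>" for N \<tau> :: mat3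
    by (simp add: matrix_mul_assoc)
  then show ?thesis using assms by (auto simp: p13_G_p12)
qed

lemma G_tw_conj:
  "G_tw (\<rho> ** \<sigma>, \<tau>0 ** \<rho>', \<tau>1 ** \<rho>') k = \<rho> ** G_tw (\<sigma>, \<tau>0, \<tau>1) k ** \<rho>'"
  by (simp add: matrix_mul_assoc)

lemma triple_class_S3:
  assumes "t' \<in> triple_class t" "S3_triple t"
  shows "S3_triple t'"
  using assms(1)
proof induction
  case base
  show ?case by (rule assms(2))
next
  case swap
  have "p12 \<in> S3" "p13 \<in> S3" by (simp_all add: S3_def)
  with swap show ?case by (simp add: S3_triple_iff S3_mult)
next
  case conj
  then show ?case by (simp add: S3_triple_iff S3_mult S3_inverse)
qed

text \<open>A swap complements both digits of the contracting word, so within a class only its shape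
  \<open>a\<close>, \<open>1 - a\<close> persists, not the value of \<open>a\<close>.\<close>

lemma triple_class_contracts:
  assumes "t' \<in> triple_class t" "a \<in> {0, 1}" "contracts t a (1 - a)"
  shows "\<exists>a\<in>{0, 1}. contracts t' a (1 - a)"
  using assms(1)
proof induction
  case base
  show ?case using assms(2,3) by blast
next
  case (swap \<sigma> \<tau>0 \<tau>1)
  then obtain a where a: "a \<in> {0, 1}" "contracts (\<sigma>, \<tau>0, \<tau>1) a (1 - a)" by blast
  then have "1 - a \<in> {0, 1}" "1 - (1 - a) = a" by auto
  moreover from a this have "contracts (\<sigma> ** p13, p12 ** \<tau>1, p12 ** \<tau>0) (1 - a) (1 - (1 - a))"
    unfolding contracts_def by (simp only: G_tw_swap simp_thms)
  ultimately show ?case by blast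
next
  case (conj \<sigma> \<tau>0 \<tau>1 \<rho>)
  then obtain a where a: "a \<in> {0, 1}" "contracts (\<sigma>, \<tau>0, \<tau>1) a (1 - a)" by blast
  let ?t = "(\<rho> ** \<sigma>, \<tau>0 ** matrix_inv \<rho>, \<tau>1 ** matrix_inv \<rho>)"
  have "contracts ?t a (1 - a)"
    unfolding contracts_def
  proof
    fix M :: mat3
    let ?G = "G_tw (\<sigma>, \<tau>0, \<tau>1)"
    \<comment> \<open>The inner \<open>matrix_inv \<rho> ** \<rho>\<close> cancels, the outer
      inverse only reorders the columns, and the leading \<open>\<rho>\<close> goes into the
      arbitrary matrix.\<close>
    have "M ** G_tw ?t a ** G_tw ?t (1 - a)
        = M ** \<rho> ** ?G a ** (matrix_inv \<rho> ** \<rho>) ** ?G (1 - a) ** matrix_inv \<rho>"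
      unfolding G_tw_conj by (simp add: matrix_mul_assoc del: G_tw.simps)
    then have "columns (M ** G_tw ?t a ** G_tw ?t (1 - a))
        = columns (M ** \<rho> ** ?G a ** ?G (1 - a))"
      using conj by (simp add: S3_inverse columns_S3 del: G_tw.simps)
    moreover have "diameter (columns (M ** \<rho> ** ?G a ** ?G (1 - a))) \<le> 3/4 * diameter (columns (M ** \<rho>))"
      using a unfolding contracts_def by blast
    ultimately show "diameter (columns (M ** G_tw ?t a ** G_tw ?t (1 - a))) \<le> 3/4 * diameter (columns M)"
      using conj by (simp add: columns_S3 del: G_tw.simps)
  qed
  with a show ?case by blast
qed

section \<open>Nested triangles and decay of their diameters\<close>

text \<open>The permutations only reorder columns, and each new vertex of a step is an old one or a
  midpoint of two old ones.\<close>

lemma columns_G_tw_subset: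
  fixes M :: mat3
  assumes "S3_triple t"
  shows "columns (M ** G_tw t k) \<subseteq> convex hull (columns M)"
proof -
  obtain \<sigma> \<tau>0 \<tau>1 where t: "t = (\<sigma>, \<tau>0, \<tau>1)" and S: "\<sigma> \<in> S3" "\<tau>0 \<in> S3" "\<tau>1 \<in> S3"
    using assms by (auto simp: S3_triple_def)
  have mid: "midpoint u v \<in> convex hull (columns N)" if "u \<in> columns N" "v \<in> columns N" for u v and N :: mat3
    using closed_segment_subset[of u "convex hull (columns N)" v] that
    by (auto simp: hull_inc)
  have "columns (N ** mG0) \<subseteq> convex hull (columns N)" "columns (N ** mG1) \<subseteq> convex hull (columns N)" for N :: mat3
    using mid[of "column 1 N" N "column 3 N"]
    by (auto simp: columns_3 column_G hull_inc)
  from this[of "M ** \<sigma>"] show ?thesis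
    using S by (simp add: t matrix_mul_assoc columns_S3)
qed

lemma diameter_G_tw_le:
  fixes M :: mat3
  assumes "S3_triple t"
  shows "diameter (columns (M ** G_tw t k)) \<le> diameter (columns M)"
proof -
  have "bounded (convex hull (columns M))"
    by (simp add: bounded_convex_hull finite_imp_bounded finite_columns)
  from diameter_subset[OF columns_G_tw_subset[OF assms] this]
  show ?thesis by (simp add: diameter_convex_hull_finite finite_columns)
qed

lemma mat_prod_snoc: "mat_prod (Ms @ [A]) = mat_prod Ms ** A"
  unfolding mat_prod_def by (induction Ms) (auto simp: matrix_mul_assoc)

text \<open>Digits enter on the right, so appending one applies a single column step to the current
  matrix.\<close>

lemma mat_prod_prefix_Suc:
  "V ** mat_prod (map f (prefix i (Suc n))) = V ** mat_prod (map f (prefix i n)) ** f (i n)"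
  by (simp add: prefix_def mat_prod_snoc matrix_mul_assoc)

text \<open>After an \<open>a\<close> beyond \<open>n\<close>, the first later \<open>1 - a\<close>
  is directly preceded by \<open>a\<close>.\<close>

lemma infinitely_often_switch:
  fixes i :: "nat \<Rightarrow> nat"
  assumes "binary_seq i" "infinite {k. i k = 0}" "infinite {k. i k = 1}" "a \<in> {0, 1}"
  shows "\<exists>k\<ge>n. i k = a \<and> i (Suc k) = 1 - a"
proof -
  have inf: "infinite {k. i k = b}" if "b \<in> {0, 1}" for b using assms(2,3) that by auto
  obtain k where k: "k \<ge> n" "i k = a"
    using inf[OF assms(4)] unfolding infinite_nat_iff_unbounded_le by auto
  have "\<exists>l>k. i l = 1 - a"
    using inf[of "1 - a"] assms(4) unfolding infinite_nat_iff_unbounded by auto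
  then have ex: "\<exists>m. i (k + m) = 1 - a" by (metis less_imp_add_positive)
  define m where "m = (LEAST m. i (k + m) = 1 - a)"
  have m: "i (k + m) = 1 - a" unfolding m_def using ex by (rule LeastI_ex)
  have "m \<noteq> 0" using m k assms(4) by (cases "m = 0") auto
  then obtain m' where m': "m = Suc m'" using not0_implies_Suc by blast
  have "i (k + m') \<noteq> 1 - a" using m' not_less_Least[of m' "\<lambda>m. i (k + m) = 1 - a"]
    unfolding m_def by simp
  moreover have "i (k + m') \<in> {0, 1}" using assms(1) by (auto simp: binary_seq_def)
  ultimately have "i (k + m') = a" using assms(4) by auto
  then show ?thesis using k m m' by (intro exI[of _ "k + m'"]) auto
qed

text \<open>The induction counts disjoint occurrences of the contracting word rather than steps:
  each adds a factor 3/4, and monotonicity covers the steps between them.\<close>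

lemma diameter_tendsto_0:
  fixes M :: "nat \<Rightarrow> mat3"
  assumes S: "S3_triple t" and c: "contracts t a (1 - a)" and a: "a \<in> {0, 1}"
    and i: "binary_seq i" "infinite {k. i k = 0}" "infinite {k. i k = 1}"
    and M: "\<And>n. M (Suc n) = M n ** G_tw t (i n)"
    and e: "e > 0"
  shows "\<exists>n. diameter (columns (M n)) < e"
proof -
  have dec: "diameter (columns (M n)) \<le> diameter (columns (M m))" if "m \<le> n" for m n
    using that by (rule lift_Suc_antimono_le[rotated]) (simp add: M diameter_G_tw_le[OF S])
  have "\<exists>n. diameter (columns (M n)) \<le> (3/4)^m * diameter (columns (M 0))" for m
  proof (induction m)
    case 0
    show ?case by (rule exI[of _ 0]) simp
  next
    case (Suc m)
    then obtain n where n: "diameter (columns (M n)) \<le> (3/4)^m * diameter (columns (M 0))" by blast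
    obtain k where k: "k \<ge> n" "i k = a" "i (Suc k) = 1 - a"
      using infinitely_often_switch[OF i a] by blast
    \<comment> \<open>The word is read at positions \<open>k\<close> and \<open>Suc k\<close>, so
      its effect appears at stage \<open>Suc (Suc k)\<close>.\<close>
    have "M (Suc (Suc k)) = M k ** G_tw t a ** G_tw t (1 - a)" using k by (simp only: M)
    then have "diameter (columns (M (Suc (Suc k)))) \<le> 3/4 * diameter (columns (M k))"
      using c by (simp add: contracts_def)
    with n dec[OF k(1)] show ?case by (intro exI[of _ "Suc (Suc k)"]) simp
  qed
  moreover have "(\<lambda>m. (3/4)^m * diameter (columns (M 0))) \<longlonglongrightarrow> 0"
    by (intro tendsto_mult_left_zero LIMSEQ_power_zero) simp
  then have "\<exists>m. (3/4)^m * diameter (columns (M 0)) < e"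
    using e by (metis (no_types, lifting) eventually_sequentially order_tendstoD(2) order_refl)
  ultimately show ?thesis by (meson le_less_trans)
qed

section \<open>Projection to the plane and the one-point intersection\<close>

text \<open>Agrees with \<open>proj\<close> on the plane of first coordinate 1, but is linear and
  1-Lipschitz everywhere, so it respects hulls and distances.\<close>

definition aff :: "real ^ 3 \<Rightarrow> real \<times> real" where
  "aff v = (v $ 2, v $ 3)"

lemma linear_aff: "linear aff"
  by (rule linearI) (simp_all add: aff_def)

lemma dist_aff_le: "dist (aff u) (aff v) \<le> dist u v"
proof -
  have "norm (aff w) \<le> norm w" for w
    by (simp add: aff_def norm_Pair norm_vec_def L2_set_def sum_3)
  then show ?thesis
    by (metis dist_norm linear_aff linear_diff)
qed

lemma proj_triangle_columns: "proj_triangle M = convex hull (proj ` columns M)"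
  by (simp add: proj_triangle_def columns_3)

lemma proj_triangle_aff:
  assumes "\<forall>v\<in>columns M. v $ 1 = 1"
  shows "proj_triangle M = aff ` (convex hull (columns M))"
proof -
  have "proj ` columns M = aff ` columns M"
    using assms by (intro image_cong) (auto simp: proj_def aff_def)
  then show ?thesis
    by (simp add: proj_triangle_columns convex_hull_linear_image linear_aff)
qed

text \<open>Cantor's intersection theorem for nested nonempty compact sets of arbitrarily small
  diameter.\<close>

lemma Gam_Inter_singleton:
  assumes S: "S3_triple t" and c: "contracts t a (1 - a)" and a: "a \<in> {0, 1}"
    and i: "binary_seq i" "infinite {k. i k = 0}" "infinite {k. i k = 1}"
  shows "\<exists>q. (\<Inter>n\<in>{1..}. Gam t (prefix i n)) = {q}"
proof -
  define M where "M n = mV ** mat_prod (map (G_tw t) (prefix i n))" for n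
  have M: "M (Suc n) = M n ** G_tw t (i n)" for n
    by (simp only: M_def mat_prod_prefix_Suc)
  define K where "K n = convex hull (columns (M n))" for n
  have sub: "columns (M (Suc n)) \<subseteq> K n" for n
    unfolding M K_def by (rule columns_G_tw_subset[OF S])
  have K: "K n \<subseteq> K m" if "m \<le> n" for m n
    using that
  proof (rule lift_Suc_antimono_le[rotated])
    show "K (Suc n) \<subseteq> K n" for n
      using sub[of n] unfolding K_def[of "Suc n"] by (rule hull_minimal) (simp add: K_def)
  qed
  \<comment> \<open>The first row of \<open>mV\<close> consists of ones and the plane of first
    coordinate 1 is convex; nesting keeps all later columns in it.\<close>
  have K0: "v $ 1 = 1" if "v \<in> K 0" for v
  proof -
    have "convex hull (columns mV) \<subseteq> {v. v $ 1 = 1}"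
      by (rule hull_minimal)
        (auto simp: columns_3 mV_def column_def vector_3 convex_def)
    then show ?thesis using that by (auto simp: K_def M_def prefix_def mat_prod_def)
  qed
  have Gam: "Gam t (prefix i n) = aff ` K n" for n
    unfolding Gam_def M_def[symmetric] K_def
    using K[of 0 n] K0 hull_subset[of "columns (M n)" convex]
    by (intro proj_triangle_aff) (auto simp: K_def)
  have comp: "compact (K n)" for n
    unfolding K_def by (simp add: finite_imp_compact compact_convex_hull finite_columns)
  \<comment> \<open>The index is shifted because the intersection starts with words of length
    1.\<close>
  have "\<exists>q. \<Inter>(range (\<lambda>n. aff ` K (Suc n))) = {q}"
  proof (rule decreasing_closed_nest_sing)
    show "closed (aff ` K (Suc n))" for n
      by (intro compact_imp_closed compact_continuous_image comp
          linear_continuous_on linear_aff linear_conv_bounded_linear[THEN iffD1])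
    show "aff ` K (Suc n) \<noteq> {}" for n by (simp add: K_def columns_3)
    show "aff ` K (Suc n) \<subseteq> aff ` K (Suc m)" if "m \<le> n" for m n
      using that by (intro image_mono K) simp
    show "\<exists>n. \<forall>x\<in>aff ` K (Suc n). \<forall>y\<in>aff ` K (Suc n). dist x y < e" if e: "e > 0" for e
    proof -
      obtain n where n: "diameter (columns (M n)) < e"
        using diameter_tendsto_0[OF S c a i M e] by blast
      have "dist (aff u) (aff v) < e" if "u \<in> K (Suc n)" "v \<in> K (Suc n)" for u v
      proof -
        have "u \<in> K n" "v \<in> K n" using that K[of n "Suc n"] by auto
        then have "dist u v \<le> diameter (K n)"
          by (intro diameter_bounded_bound compact_imp_bounded comp)
        with n show ?thesis using dist_aff_le[of u v] by (simp add: K_def diameter_convex_hull_finite finite_columns)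
      qed
      then show ?thesis by blast
    qed
  qed
  moreover have "(\<Inter>n\<in>{1..}. Gam t (prefix i n)) = \<Inter>(range (\<lambda>n. aff ` K (Suc n)))"
  proof -
    have "{1..} = range Suc" by (auto simp: image_iff Suc_le_eq gr0_conv_Suc)
    then show ?thesis by (simp add: Gam image_image)
  qed
  ultimately show ?thesis by simp
qed

section \<open>Uniqueness of the digit sequence\<close>

text \<open>Invariant of the F-steps: invertibility makes the triangle nondegenerate, positive first
  entries make \<open>proj\<close> meaningful. First entries add up under F, so \<open>aff\<close>
  cannot replace \<open>proj\<close> here.\<close>

definition pos_invertible :: "mat3 \<Rightarrow> bool" where
  "pos_invertible M \<longleftrightarrow> invertible M \<and> (\<forall>v\<in>columns M. v $ 1 > 0)"

lemma pos_invertible_F_tw: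
  assumes "S3_triple t" "pos_invertible M"
  shows "pos_invertible (M ** F_tw t k)"
proof -
  obtain \<sigma> \<tau>0 \<tau>1 where t: "t = (\<sigma>, \<tau>0, \<tau>1)" and S: "\<sigma> \<in> S3" "\<tau>0 \<in> S3" "\<tau>1 \<in> S3"
    using assms by (auto simp: S3_triple_def)
  have "invertible mF0" "invertible mF1"
    by (simp_all add: invertible_det_nz det_3 mF0_def mF1_def vector_3)
  then have "invertible (M ** F_tw t k)"
    using S assms by (simp add: t pos_invertible_def invertible_mult S3_inverse)
  moreover have "v $ 1 > 0" if "v \<in> columns (M ** F_tw t k)" for v
  proof -
    have M: "\<forall>v\<in>columns (M ** \<sigma>). v $ 1 > 0"
      using assms S by (simp add: pos_invertible_def columns_S3)
    have "v \<in> columns (M ** \<sigma> ** mF0) \<union> columns (M ** \<sigma> ** mF1)"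
      using that S by (auto simp: t matrix_mul_assoc columns_S3 split: if_splits)
    then show ?thesis using M by (auto simp: columns_3 column_F)
  qed
  ultimately show ?thesis by (simp add: pos_invertible_def)
qed

lemma pos_invertible_prefix:
  assumes "S3_triple t"
  shows "pos_invertible (mV ** mat_prod (map (F_tw t) (prefix i n)))"
proof (induction n)
  case 0
  have "pos_invertible mV"
    by (simp add: pos_invertible_def invertible_det_nz det_3 columns_3 column_def mV_def vector_3)
  then show ?case by (simp add: prefix_def mat_prod_def)
next
  case (Suc n)
  then show ?case unfolding mat_prod_prefix_Suc by (rule pos_invertible_F_tw[OF assms])
qed

text \<open>Dividing the homogeneous inequality by the positive first coordinate gives an affine one
  for the projected vertices; convexity of the half-plane extends it to the hull.\<close>

lemma proj_triangle_halfplane: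
  fixes l :: "real ^ 3"
  assumes "\<forall>v\<in>columns M. v $ 1 > 0" "\<forall>v\<in>columns M. l \<bullet> v \<ge> 0"
  shows "proj_triangle M \<subseteq> {p. (l $ 2, l $ 3) \<bullet> p \<ge> - l $ 1}"
  unfolding proj_triangle_columns
proof (rule hull_minimal)
  show "proj ` columns M \<subseteq> {p. (l $ 2, l $ 3) \<bullet> p \<ge> - l $ 1}"
  proof (rule image_subsetI)
    fix v assume v: "v \<in> columns M"
    have "0 \<le> (l \<bullet> v) / v $ 1" using assms v by (simp add: less_imp_le)
    also have "\<dots> = l $ 1 + (l $ 2, l $ 3) \<bullet> proj v"
      using assms(1) v by (auto simp: inner_vec_def sum_3 proj_def field_simps dest!: bspec)
    finally show "proj v \<in> {p. (l $ 2, l $ 3) \<bullet> p \<ge> - l $ 1}" by simp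
  qed
qed (rule convex_halfspace_ge)

text \<open>A linear form negative on \<open>a\<close>, positive on \<open>c\<close> and zero on
  \<open>b\<close> and \<open>a + c\<close> puts the two children in opposite closed
  half-planes.\<close>

lemma interior_children_disjoint:
  assumes "S3_triple t" and M: "pos_invertible M"
  shows "interior (proj_triangle (M ** F_tw t 0)) \<inter> interior (proj_triangle (M ** F_tw t 1)) = {}"
proof (rule ccontr)
  assume "\<not> ?thesis"
  then obtain p where p: "p \<in> interior (proj_triangle (M ** F_tw t 0))"
      "p \<in> interior (proj_triangle (M ** F_tw t 1))"
    by blast
  obtain \<sigma> \<tau>0 \<tau>1 where t: "t = (\<sigma>, \<tau>0, \<tau>1)" and S: "\<sigma> \<in> S3" "\<tau>0 \<in> S3" "\<tau>1 \<in> S3"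
    using assms by (auto simp: S3_triple_def)
  define a b c where abc: "a = column 1 (M ** \<sigma>)" "b = column 2 (M ** \<sigma>)" "c = column 3 (M ** \<sigma>)"
  have "invertible (M ** \<sigma>)"
    using M S by (simp add: pos_invertible_def invertible_mult S3_inverse)
  then obtain N where N: "N ** (M ** \<sigma>) = mat 1" by (auto simp: invertible_def)
  \<comment> \<open>The line through \<open>b\<close> and \<open>a + c\<close> separates the two subtriangles.\<close>
  define l where "l = row 3 N - row 1 N"
  \<comment> \<open>The rows of the inverse form the basis dual to the columns, which gives
    \<open>l\<close> the values -1, 0, 1 on \<open>a\<close>, \<open>b\<close>,
    \<open>c\<close>.\<close>
  have "row k N \<bullet> column j (M ** \<sigma>) = (if k = j then 1 else 0)" for k j
    using N by (simp add: vec_eq_iff mat_def matrix_matrix_mult_def inner_vec_def row_def column_def)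
  then have l: "l \<bullet> a = -1" "l \<bullet> b = 0" "l \<bullet> c = 1"
    unfolding l_def abc by (simp_all add: inner_diff_left)
  have pos: "\<forall>v\<in>columns (M ** F_tw t k). v $ 1 > 0" for k
    using pos_invertible_F_tw[OF assms] by (simp add: pos_invertible_def)
  have col: "columns (M ** F_tw t 0) = {b, c, a + c}" "columns (M ** F_tw t 1) = {a, b, a + c}"
    using S by (simp_all add: t matrix_mul_assoc columns_S3) (simp_all add: columns_3 column_F abc)
  let ?H = "\<lambda>l::real^3. {p. (l $ 2, l $ 3) \<bullet> p \<ge> - l $ 1}"
  have sub: "proj_triangle (M ** F_tw t 0) \<subseteq> ?H l" "proj_triangle (M ** F_tw t 1) \<subseteq> ?H (- l)"
    by (rule proj_triangle_halfplane[OF pos], unfold col, simp add: l inner_add_right)+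
  then have int: "p \<in> interior (?H l)" "p \<in> interior (?H (- l))"
    using p interior_mono by blast+
  show False
  \<comment> \<open>If the normal vanishes, the sets are no half-planes; the two inequalities then
    force \<open>l $ 1 = 0\<close>, against \<open>l \<bullet> c = 1\<close>.\<close>
  proof (cases "(l $ 2, l $ 3) = 0")
    case True
    moreover have "p \<in> ?H l" "p \<in> ?H (- l)" using int interior_subset by blast+
    ultimately have "l = 0" by (cases p) (simp add: vec_eq_iff forall_3 zero_prod_def)
    with l show False by simp
  next
    case False
    then have "((- l) $ 2, (- l) $ 3) \<noteq> 0" by (simp add: zero_prod_def)
    from int(2)[unfolded interior_halfspace_ge[OF this]] int(1)[unfolded interior_halfspace_ge[OF False]]
    show False by (cases p) simp
  qed
qed

text \<open>By strong induction the prefixes of length \<open>k\<close> agree, so the next digits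
  choose children of one common triangle, and different children have disjoint interiors.\<close>

lemma binary_seq_unique:
  assumes S: "S3_triple t" and ij: "binary_seq i" "binary_seq j"
    and i: "\<forall>n\<ge>1. p \<in> interior (Tri t (prefix i n))"
    and j: "\<forall>n\<ge>1. p \<in> interior (Tri t (prefix j n))"
  shows "i = j"
proof
  fix k
  show "i k = j k"
  proof (induction k rule: less_induct)
    case (less k)
    then have eq: "prefix j k = prefix i k" by (simp add: prefix_def)
    define M where "M = mV ** mat_prod (map (F_tw t) (prefix i k))"
    have "p \<in> interior (proj_triangle (M ** F_tw t (i k)))"
      using i[rule_format, of "Suc k"] by (simp add: Tri_def M_def mat_prod_prefix_Suc)
    moreover have "p \<in> interior (proj_triangle (M ** F_tw t (j k)))"
      using j[rule_format, of "Suc k"] by (simp add: Tri_def M_def mat_prod_prefix_Suc eq)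
    moreover have "pos_invertible M" unfolding M_def by (rule pos_invertible_prefix[OF S])
    note interior_children_disjoint[OF S this]
    moreover have "i k \<in> {0, 1}" "j k \<in> {0, 1}" using ij by (auto simp: binary_seq_def)
    ultimately show ?case by auto
  qed
qed

section \<open>The value of \<open>Phi\<close> at an interior point\<close>

theorem mainTheorem8:
  fixes t :: triple and i :: "nat \<Rightarrow> nat"
  assumes "t \<in> triple_class (pe, p12, p12) \<or> t \<in> triple_class (pe, p13, pe)"
    and "binary_seq i"
    and "infinite {k. i k = 0}" and "infinite {k. i k = 1}"
  shows "(\<exists>q. (\<Inter>n\<in>{1..}. Gam t (prefix i n)) = {q}) \<and>
    (\<forall>x y. (\<forall>n\<ge>1. (x, y) \<in> interior (Tri t (prefix i n))) \<longrightarrow> (\<exists>q. Phi t `` {(x, y)} = {q}))"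
proof -
  have "S3_triple (pe, p12, p12)" "S3_triple (pe, p13, pe)"
    by (simp_all add: S3_triple_iff S3_def)
  then have S: "S3_triple t" using assms(1) triple_class_S3 by blast
  have "contracts (pe, p12, p12) 1 (1 - 1)" "contracts (pe, p13, pe) 0 (1 - 0)"
    by (simp_all add: contracts_p12[simplified] contracts_p13[simplified])
  then have "\<exists>a\<in>{0, 1}. contracts t a (1 - a)"
    using assms(1) triple_class_contracts by blast
  then obtain q where q: "(\<Inter>n\<in>{1..}. Gam t (prefix i n)) = {q}"
    using Gam_Inter_singleton[OF S _ _ assms(2-4)] by blast
  have "Phi t `` {(x, y)} = {q}" if xy: "\<forall>n\<ge>1. (x, y) \<in> interior (Tri t (prefix i n))" for x y
  proof -
    \<comment> \<open>\<open>Phi\<close> ranges over all sequences admissible for the point;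
      uniqueness leaves only \<open>i\<close>, so its value is the intersection already
      computed.\<close>
    have uniq: "j = i" if "binary_seq j" "\<forall>n\<ge>1. (x, y) \<in> interior (Tri t (prefix j n))" for j
      using binary_seq_unique[OF S that(1) assms(2) that(2) xy] .
    have "Phi t `` {(x, y)} = (\<Inter>n\<in>{1..}. Gam t (prefix i n))" (is "_ = ?I")
    proof (intro set_eqI iffI)
      fix p assume "p \<in> Phi t `` {(x, y)}"
      then obtain j where "binary_seq j" "\<forall>n\<ge>1. (x, y) \<in> interior (Tri t (prefix j n))"
        and "p \<in> (\<Inter>n\<in>{1..}. Gam t (prefix j n))"
        unfolding Phi_def by blast
      with uniq show "p \<in> ?I" by simp
    next
      fix p assume "p \<in> ?I"
      then show "p \<in> Phi t `` {(x, y)}"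
        unfolding Phi_def using assms(2) xy by blast
    qed
    then show ?thesis using q by simp
  qed
  with q show ?thesis by blast
qed

end
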